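(* Let $D\subset\mathbb{R}^2$ be a closed set with $\operatorname{reach}(D)>0$. If $0\le r<\operatorname{reach}(D)$, then $D_r$ deformation retracts onto $D$. Consequently, $$H_q(D_r;\mathbb{F}_2)\cong H_q(D;\mathbb{F}_2),\qquad \beta_q(D_r)=\beta_q(D),\qquad q=0,1.$$
   Context: For a closed set $D\subset\mathbb{R}^2$, let $\rho_D(x)=\operatorname{dist}(x,D)$ be the Euclidean distance from $x$ to $D$, and for $r\ge 0$ let $D_r=\{x\in\mathbb{R}^2:\rho_D(x)\le r\}$ be the closed $r$-offset of $D$. The reach of $D$ is $$\operatorname{reach}(D)=\sup\{\rho>0:\text{every }x\in\mathbb{R}^2\text{ with }\rho_D(x)<\rho\text{ has a unique nearest point in }D\}.$$ $H_q(A;\mathbb{F}_2)$ is the $q$th homology group of $A$ with coefficients in the two-element field $\mathbb{F}_2$, and $\beta_q(A)=\operatorname{rank}H_q(A;\mathbb{F}_2)$. *)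

theory Defs
  imports "HOL-Analysis.Analysis" "HOL-Homology.Homology" "HOL-Library.Z2"
begin

section \<open>Distance, offsets and reach\<close>

text \<open>Since \<^term>\<open>infdist x {} = 0\<close> in the library, the usual convention that the distance
  to the empty set is infinite is made explicit.\<close>

definition rho :: "'a::metric_space set \<Rightarrow> 'a \<Rightarrow> ennreal" where
  "rho D x = (if D = {} then \<infinity> else ennreal (infdist x D))"

definition offset :: "'a::metric_space set \<Rightarrow> real \<Rightarrow> 'a set" where
  "offset D r = {x. rho D x \<le> ennreal r}"

definition nearest_point :: "'a::metric_space set \<Rightarrow> 'a \<Rightarrow> 'a \<Rightarrow> bool" where
  "nearest_point D x p \<longleftrightarrow> p \<in> D \<and> (\<forall>y\<in>D. dist x p \<le> dist x y)"

text \<open>The supremum is taken in the extended nonnegative reals: it may be infinite (e.g. if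
  \<^term>\<open>D\<close> is convex and closed), and it is \<^term>\<open>0\<close> if no \<^term>\<open>s\<close> qualifies.\<close>

definition reach :: "'a::metric_space set \<Rightarrow> ennreal" where
  "reach D = Sup {ennreal s | s. 0 < s \<and>
     (\<forall>x. rho D x < ennreal s \<longrightarrow> (\<exists>!p. nearest_point D x p))}"

section \<open>Deformation retractions\<close>

text \<open>The homotopy stays inside \<^term>\<open>S\<close> and keeps the points of \<^term>\<open>T\<close> fixed at all times.\<close>

definition deformation_retracts_onto :: "'a::topological_space set \<Rightarrow> 'a set \<Rightarrow> bool" where
  "deformation_retracts_onto S T \<longleftrightarrow>
     (\<exists>g. retraction S T g \<and> homotopic_with_canon (\<lambda>f. \<forall>x\<in>T. f x = x) S S id g)"

section \<open>Singular homology with coefficients in the two-element field\<close>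

text \<open>The type \<^typ>\<open>bit\<close> is the field with two elements. Singular simplices and their faces are
  those of the library, whose own chains have integer coefficients.\<close>

type_synonym 'a chain_F2 = "((nat \<Rightarrow> real) \<Rightarrow> 'a) \<Rightarrow>\<^sub>0 bit"

definition chains_F2 :: "nat \<Rightarrow> 'a topology \<Rightarrow> 'a chain_F2 set" where
  "chains_F2 q X = {c. Poly_Mapping.keys c \<subseteq> singular_simplex_set q X}"

definition boundary_F2 :: "nat \<Rightarrow> 'a chain_F2 \<Rightarrow> 'a chain_F2" where
  "boundary_F2 q c =
     (if q = 0 then 0
      else \<Sum>f\<in>Poly_Mapping.keys c. \<Sum>k\<le>q.
             Poly_Mapping.single (singular_face q k f) ((-1) ^ k * Poly_Mapping.lookup c f))"

definition cycle_group_F2 :: "nat \<Rightarrow> 'a topology \<Rightarrow> 'a chain_F2 monoid" where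
  "cycle_group_F2 q X =
     \<lparr>carrier = {c \<in> chains_F2 q X. boundary_F2 q c = 0}, monoid.mult = (+), one = 0\<rparr>"

definition boundaries_F2 :: "nat \<Rightarrow> 'a topology \<Rightarrow> 'a chain_F2 set" where
  "boundaries_F2 q X = boundary_F2 (Suc q) ` chains_F2 (Suc q) X"

text \<open>The homology is recorded as an abelian group, written multiplicatively as everywhere in
  \<^theory>\<open>HOL-Algebra.Coset\<close>. The scalar multiplication by \<^term>\<open>0 :: bit\<close> and \<^term>\<open>1 :: bit\<close> is
  determined by the group structure, so group isomorphisms between such groups are the same as
  linear isomorphisms over the two-element field.\<close>

definition homology_group_F2 :: "nat \<Rightarrow> 'a topology \<Rightarrow> 'a chain_F2 set monoid" where
  "homology_group_F2 q X = cycle_group_F2 q X Mod boundaries_F2 q X"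

text \<open>Linear independence over the two-element field: the only coefficients are 0 and 1, so a
  linear combination of elements of \<^term>\<open>S\<close> with all nonzero coefficients on \<^term>\<open>T\<close> is the
  sum of the elements of the finite subset \<^term>\<open>T\<close>, i.e. their product in the multiplicative
  notation.\<close>

definition independent_F2 :: "('g, 'm) monoid_scheme \<Rightarrow> 'g set \<Rightarrow> bool" where
  "independent_F2 G S \<longleftrightarrow> S \<subseteq> carrier G \<and>
     (\<forall>T. finite T \<and> T \<subseteq> S \<and> finprod G (\<lambda>x. x) T = \<one>\<^bsub>G\<^esub> \<longrightarrow> T = {})"

text \<open>The dimension over the two-element field, \<^term>\<open>\<infinity> :: enat\<close> if it is not finite.\<close>

definition rank_F2 :: "('g, 'm) monoid_scheme \<Rightarrow> enat" where
  "rank_F2 G = Sup {enat (card S) | S. finite S \<and> independent_F2 G S}"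

definition betti_F2 :: "nat \<Rightarrow> 'a topology \<Rightarrow> enat" where
  "betti_F2 q X = rank_F2 (homology_group_F2 q X)"

end

theory Submission
  imports Defs
begin

text \<open>For \<open>r < reach D\<close> every point of the offset has a unique nearest point in \<open>D\<close>, and this
  projection is continuous. Moving along the segment from a point to its projection does not
  increase the distance to \<open>D\<close>, so the straight-line homotopy is a deformation retraction. Its
  prism operator \<open>P\<close> satisfies \<open>\<partial>P + P\<partial> = id + g\<close> on chains, where \<open>g\<close> is induced by the
  projection. Hence every cycle of the offset is homologous to one in \<open>D\<close>, and a cycle of \<open>D\<close> that
  bounds in the offset bounds in \<open>D\<close>, as one sees by projecting the bounding chain.\<close>

section \<open>Linear extension over the two-element field\<close>

abbreviation gen_F2 :: "'a \<Rightarrow> 'a \<Rightarrow>\<^sub>0 bit" where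
  "gen_F2 a \<equiv> Poly_Mapping.single a 1"

text \<open>Every nonzero coefficient is 1, so a chain is the sum of its support and linear
  extension needs no scalars.\<close>

definition extend_F2 :: "('a \<Rightarrow> 'b \<Rightarrow>\<^sub>0 bit) \<Rightarrow> ('a \<Rightarrow>\<^sub>0 bit) \<Rightarrow> 'b \<Rightarrow>\<^sub>0 bit" where
  "extend_F2 F c = (\<Sum>a\<in>Poly_Mapping.keys c. F a)"

lemma bit_add_self: "(a :: bit) + a = 0"
  by (cases a) simp_all

lemma add_self_F2: "(c :: 'a \<Rightarrow>\<^sub>0 bit) + c = 0"
  by (rule poly_mapping_eqI) (simp only: lookup_add bit_add_self lookup_zero)

lemma add_self_left_F2: "(c :: 'a \<Rightarrow>\<^sub>0 bit) + (c + d) = d"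
  by (simp add: add_self_F2 flip: add.assoc)

text \<open>A common finite index set makes the sums for \<open>c\<close>, \<open>d\<close> and
  \<open>c + d\<close> comparable term by term.\<close>

lemma extend_F2_superset:
  assumes "finite K" "Poly_Mapping.keys c \<subseteq> K"
  shows "extend_F2 F c = (\<Sum>a\<in>K. if Poly_Mapping.lookup c a = 1 then F a else 0)"
proof -
  have "extend_F2 F c =
      (\<Sum>a\<in>Poly_Mapping.keys c. if Poly_Mapping.lookup c a = 1 then F a else 0)"
    unfolding extend_F2_def by (rule sum.cong) (auto simp: in_keys_iff)
  also have "\<dots> = (\<Sum>a\<in>K. if Poly_Mapping.lookup c a = 1 then F a else 0)"
    by (rule sum.mono_neutral_left) (use assms in \<open>auto simp: in_keys_iff\<close>)
  finally show ?thesis .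
qed

lemma extend_F2_0 [simp]: "extend_F2 F 0 = 0"
  by (simp add: extend_F2_def)

lemma extend_F2_gen [simp]: "extend_F2 F (gen_F2 a) = F a"
  by (simp add: extend_F2_def)

lemma extend_F2_add: "extend_F2 F (c + d) = extend_F2 F c + extend_F2 F d"
proof -
  let ?K = "Poly_Mapping.keys c \<union> Poly_Mapping.keys d"
  have K: "finite ?K" "Poly_Mapping.keys (c + d) \<subseteq> ?K"
    using keys_add [of c d] by auto
  \<comment> \<open>If both coefficients are 1, then \<open>a\<close> drops out of
    \<open>c + d\<close>, and on the right \<open>F a\<close> cancels against itself.\<close>
  have *: "(if Poly_Mapping.lookup (c + d) a = 1 then F a else 0) =
      (if Poly_Mapping.lookup c a = 1 then F a else 0) +
      (if Poly_Mapping.lookup d a = 1 then F a else 0)" for a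
    by (cases "Poly_Mapping.lookup c a"; cases "Poly_Mapping.lookup d a")
      (simp_all add: lookup_add add_self_F2)
  show ?thesis
    using K by (simp add: extend_F2_superset [of ?K] * sum.distrib)
qed

lemma extend_F2_sum: "extend_F2 F (sum g I) = (\<Sum>i\<in>I. extend_F2 F (g i))"
  by (induction I rule: infinite_finite_induct) (simp_all add: extend_F2_add)

text \<open>The boundary in positive degree, chain maps and the prism are all linear extensions;
  with this, identities between their composites reduce to single simplices.\<close>

lemma extend_F2_extend: "extend_F2 G (extend_F2 F c) = extend_F2 (\<lambda>a. extend_F2 G (F a)) c"
  unfolding extend_F2_def [of F] extend_F2_sum by (simp add: extend_F2_def)

lemma extend_F2_plus: "extend_F2 (\<lambda>a. F a + G a) c = extend_F2 F c + extend_F2 G c"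
  by (simp add: extend_F2_def sum.distrib)

lemma extend_F2_cong:
  "(\<And>a. a \<in> Poly_Mapping.keys c \<Longrightarrow> F a = G a) \<Longrightarrow> extend_F2 F c = extend_F2 G c"
  by (simp add: extend_F2_def)

lemma extend_F2_id: "extend_F2 gen_F2 c = c"
proof (rule poly_mapping_eqI)
  fix a
  show "Poly_Mapping.lookup (extend_F2 gen_F2 c) a = Poly_Mapping.lookup c a"
    by (cases "a \<in> Poly_Mapping.keys c")
      (auto simp: extend_F2_def lookup_sum lookup_single when_def in_keys_iff)
qed

section \<open>Chain groups and their closure properties\<close>

lemma chains_F2_0 [simp]: "0 \<in> chains_F2 q X"
  by (simp add: chains_F2_def)

lemma chains_F2_add: "c \<in> chains_F2 q X \<Longrightarrow> d \<in> chains_F2 q X \<Longrightarrow> c + d \<in> chains_F2 q X"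
  using keys_add [of c d] by (auto simp: chains_F2_def)

lemma chains_F2_sum: "(\<And>i. i \<in> I \<Longrightarrow> g i \<in> chains_F2 q X) \<Longrightarrow> sum g I \<in> chains_F2 q X"
  by (induction I rule: infinite_finite_induct) (auto simp: chains_F2_add)

lemma gen_F2_in_chains: "gen_F2 f \<in> chains_F2 q X \<longleftrightarrow> singular_simplex q X f"
  by (simp add: chains_F2_def)

lemma extend_F2_in_chains:
  assumes "c \<in> chains_F2 p X" "\<And>f. singular_simplex p X f \<Longrightarrow> F f \<in> chains_F2 q Y"
  shows "extend_F2 F c \<in> chains_F2 q Y"
  unfolding extend_F2_def by (rule chains_F2_sum) (use assms in \<open>auto simp: chains_F2_def\<close>)

lemma chains_F2_mono: "T \<subseteq> S \<Longrightarrow> chains_F2 q (subtopology X T) \<subseteq> chains_F2 q (subtopology X S)"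
  by (auto simp: chains_F2_def dest: singular_simplex_mono)

section \<open>The boundary operator\<close>

lemma boundary_F2_0: "boundary_F2 0 c = 0"
  by (simp add: boundary_F2_def)

text \<open>Modulo 2 the signs are 1, as are the coefficients on the support.\<close>

lemma boundary_F2_Suc:
  "boundary_F2 (Suc q) c = extend_F2 (\<lambda>f. \<Sum>k\<le>Suc q. gen_F2 (singular_face (Suc q) k f)) c"
proof -
  have "(-1 :: bit) ^ k * Poly_Mapping.lookup c f = 1" if "f \<in> Poly_Mapping.keys c" for f k
    using that by (simp add: in_keys_iff)
  then show ?thesis
    unfolding boundary_F2_def extend_F2_def by simp
qed

lemma boundary_F2_zero [simp]: "boundary_F2 q 0 = 0"
  by (simp add: boundary_F2_def)

lemma boundary_F2_add: "boundary_F2 q (c + d) = boundary_F2 q c + boundary_F2 q d"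
  by (cases q) (simp_all add: boundary_F2_0 boundary_F2_Suc extend_F2_add)

lemma boundary_F2_in_chains: "c \<in> chains_F2 (Suc q) X \<Longrightarrow> boundary_F2 (Suc q) c \<in> chains_F2 q X"
  unfolding boundary_F2_Suc
  by (erule extend_F2_in_chains)
    (use singular_simplex_singular_face [of "Suc q" X]
      in \<open>auto intro!: chains_F2_sum simp: gen_F2_in_chains simp del: sum.atMost_Suc\<close>)

text \<open>Both composites insert zeros at positions \<open>i\<close> and \<open>Suc j\<close>:
  inserting at \<open>i\<close> pushes an earlier zero at \<open>j\<close> one place up.\<close>

lemma singular_face_singular_face_le:
  assumes "i \<le> j" "j \<le> Suc q"
  shows "singular_face (Suc q) j (singular_face (Suc (Suc q)) i f) =
    singular_face (Suc q) i (singular_face (Suc (Suc q)) (Suc j) f)"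
proof -
  have eq: "simplical_face i (simplical_face j x) = simplical_face (Suc j) (simplical_face i x)"
    for x :: "nat \<Rightarrow> real"
  proof
    fix n
    show "simplical_face i (simplical_face j x) n = simplical_face (Suc j) (simplical_face i x) n"
      using assms by (cases n) (auto simp: simplical_face_def)
  qed
  show ?thesis
    using assms simplical_face_in_standard_simplex [of "Suc q" j] simplical_face_in_standard_simplex [of "Suc q" i]
    by (auto simp: singular_face_def fun_eq_iff restrict_def eq)
qed

lemma boundary_boundary_F2: "boundary_F2 q (boundary_F2 (Suc q) c) = 0"
proof (cases q)
  case 0
  then show ?thesis by (simp add: boundary_F2_0)
next
  case (Suc p)
  let ?d = "\<lambda>j i f. gen_F2 (singular_face (Suc p) j (singular_face (Suc (Suc p)) i f))"
  let ?U = "{(i, j). i \<le> j \<and> j \<le> Suc p}" and ?L = "{(i, j). j < i \<and> i \<le> Suc (Suc p)}"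
  have "(\<Sum>i\<le>Suc (Suc p). \<Sum>j\<le>Suc p. ?d j i f) = 0" for f :: "(nat \<Rightarrow> real) \<Rightarrow> 'a"
  proof -
    have "(\<Sum>i\<le>Suc (Suc p). \<Sum>j\<le>Suc p. ?d j i f) =
        (\<Sum>(i, j)\<in>{..Suc (Suc p)} \<times> {..Suc p}. ?d j i f)"
      by (rule sum.cartesian_product)
    also have "{..Suc (Suc p)} \<times> {..Suc p} = ?U \<union> ?L"
      by auto
    also have "(\<Sum>(i, j)\<in>?U \<union> ?L. ?d j i f) = (\<Sum>(i, j)\<in>?U. ?d j i f) + (\<Sum>(i, j)\<in>?L. ?d j i f)"
    proof (rule sum.union_disjoint)
      show "finite ?U" "finite ?L"
        by (rule finite_subset [of _ "{..Suc (Suc p)} \<times> {..Suc p}"], auto)+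
    qed auto
    \<comment> \<open>Sending \<open>(i, j)\<close> to \<open>(Suc j, i)\<close> matches equal
      double faces of \<open>?U\<close> and \<open>?L\<close>, so the two halves of the sum cancel
      modulo 2.\<close>
    also have "(\<Sum>(i, j)\<in>?U. ?d j i f) = (\<Sum>(i, j)\<in>?L. ?d j i f)"
      by (rule sum.reindex_bij_witness [where i = "\<lambda>(i, j). (j, i - 1)" and j = "\<lambda>(i, j). (Suc j, i)"])
        (auto simp: singular_face_singular_face_le)
    finally show ?thesis
      by (simp add: add_self_F2)
  qed
  then have "extend_F2 (\<lambda>f. \<Sum>i\<le>Suc (Suc p). \<Sum>j\<le>Suc p. ?d j i f) c = 0"
    by (simp only: extend_F2_def sum.neutral_const)
  then show ?thesis
    unfolding Suc boundary_F2_Suc extend_F2_extend extend_F2_sum extend_F2_gen .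
qed

section \<open>Induced chain maps\<close>

definition chain_map_F2 :: "nat \<Rightarrow> ('a \<Rightarrow> 'b) \<Rightarrow> 'a chain_F2 \<Rightarrow> 'b chain_F2" where
  "chain_map_F2 q g = extend_F2 (\<lambda>f. gen_F2 (simplex_map q g f))"

lemma chain_map_F2_in_chains:
  "c \<in> chains_F2 q X \<Longrightarrow> continuous_map X Y g \<Longrightarrow> chain_map_F2 q g c \<in> chains_F2 q Y"
  unfolding chain_map_F2_def
  by (erule extend_F2_in_chains) (simp add: gen_F2_in_chains singular_simplex_simplex_map)

text \<open>Simplices take values in \<open>topspace X\<close>, so this covers the identity as well
  as a retraction acting on chains of the retract.\<close>

lemma chain_map_F2_id:
  assumes "c \<in> chains_F2 q X" "\<And>x. x \<in> topspace X \<Longrightarrow> g x = x"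
  shows "chain_map_F2 q g c = c"
proof -
  have "chain_map_F2 q g c = extend_F2 gen_F2 c"
    unfolding chain_map_F2_def
    by (rule extend_F2_cong) (use assms in \<open>auto simp: chains_F2_def simplex_map_id_gen\<close>)
  then show ?thesis
    by (simp add: extend_F2_id)
qed

text \<open>Faces precompose while \<open>g\<close> postcomposes.\<close>

lemma boundary_chain_map_F2:
  "boundary_F2 (Suc q) (chain_map_F2 (Suc q) g c) = chain_map_F2 q g (boundary_F2 (Suc q) c)"
proof -
  have "singular_face (Suc q) k (simplex_map (Suc q) g f) = simplex_map q g (singular_face (Suc q) k f)"
    if "k \<le> Suc q" for k f
    using singular_face_simplex_map [of "Suc q" k g f] that
    by (auto simp: simplex_map_def singular_face_def fun_eq_iff)
  then show ?thesis
    unfolding chain_map_F2_def boundary_F2_Suc extend_F2_extend extend_F2_sum extend_F2_gen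
    by (intro extend_F2_cong sum.cong) auto
qed

section \<open>The prism operator\<close>

text \<open>The simplicial degeneracy in barycentric coordinates: the vertices \<open>k\<close> and
  \<open>Suc k\<close> are both sent to vertex \<open>k\<close>.\<close>

definition degeneracy :: "nat \<Rightarrow> (nat \<Rightarrow> real) \<Rightarrow> nat \<Rightarrow> real" where
  "degeneracy k x = (\<lambda>i. if i < k then x i else if i = k then x k + x (Suc k) else x (Suc i))"

lemma sum_degeneracy:
  "(\<Sum>i<n. degeneracy k x i) = (if n \<le> k then \<Sum>i<n. x i else \<Sum>i<Suc n. x i)"
  by (induction n) (auto simp: degeneracy_def le_Suc_eq not_le less_Suc_eq)

text \<open>Initial sums of coordinates serve as the time in the prism; this records how an inserted
  zero shifts the cut between times 1 and 0.\<close>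

lemma sum_simplical_face:
  fixes x :: "nat \<Rightarrow> real"
  shows "(\<Sum>i<Suc n. simplical_face k x i) = (if k \<le> n then \<Sum>i<n. x i else \<Sum>i<Suc n. x i)"
  by (induction n) (auto simp: simplical_face_def le_Suc_eq not_le)

lemma sum_standard_simplex:
  assumes "x \<in> standard_simplex q" "q \<le> n"
  shows "(\<Sum>i\<le>n. x i) = 1"
  using standard_simplex_mono [OF assms(2)] assms(1) by (auto simp: standard_simplex_def)

lemma sum_standard_simplex_01:
  assumes "x \<in> standard_simplex q"
  shows "(\<Sum>i<n. x i) \<in> {0..1}"
proof -
  have x: "0 \<le> x i" for i
    using assms by (simp add: standard_simplex_def)
  \<comment> \<open>The bound \<open>max q n\<close> takes in all terms of the given sum and all
    coordinates that can be nonzero.\<close>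
  then have "(\<Sum>i<n. x i) \<le> (\<Sum>i\<le>max q n. x i)"
    by (intro sum_mono2) auto
  also have "\<dots> = 1"
    by (rule sum_standard_simplex [OF assms]) simp
  finally show ?thesis
    using x by (simp add: sum_nonneg)
qed

lemma degeneracy_in_standard_simplex:
  assumes "x \<in> standard_simplex (Suc q)" "k \<le> q"
  shows "degeneracy k x \<in> standard_simplex q"
proof -
  have x: "0 \<le> x i" "\<And>i. i > Suc q \<Longrightarrow> x i = 0" for i
    using assms by (auto simp: standard_simplex_def)
  have 0: "0 \<le> degeneracy k x i" for i
    using x by (simp add: degeneracy_def)
  have 1: "(\<Sum>i\<le>q. degeneracy k x i) = 1"
    using sum_degeneracy [of k x "Suc q"] sum_standard_simplex [OF assms(1), of "Suc q"] assms(2)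
    by (simp only: lessThan_Suc_atMost) auto
  have 2: "degeneracy k x i = 0" if "i > q" for i
    using that x assms(2) by (auto simp: degeneracy_def)
  have "degeneracy k x i \<le> 1" for i
    using member_le_sum [of i "{..q}" "degeneracy k x"] 0 1 2 [of i]
    by (cases "i \<le> q") auto
  then show ?thesis
    using 0 1 2 by (auto simp: standard_simplex_def)
qed

text \<open>First of three cosimplicial identities; they decide which faces of a prism simplex lie
  over a face of \<open>f\<close> and which are slices through the prism over
  \<open>f\<close>.\<close>

lemma degeneracy_simplical_face_less:
  "j < k \<Longrightarrow> degeneracy k (simplical_face j x) = simplical_face j (degeneracy (k - 1) x)"
  by (rule ext) (auto simp: degeneracy_def simplical_face_def)

lemma degeneracy_simplical_face_greater:
  assumes "Suc k < j"
  shows "degeneracy k (simplical_face j x) = simplical_face (j - 1) (degeneracy k x)"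
proof
  fix i
  show "degeneracy k (simplical_face j x) i = simplical_face (j - 1) (degeneracy k x) i"
    using assms by (cases i) (auto simp: degeneracy_def simplical_face_def)
qed

lemma degeneracy_simplical_face_same:
  "j = k \<or> j = Suc k \<Longrightarrow> degeneracy k (simplical_face j x) = x"
  by (rule ext) (auto simp: degeneracy_def simplical_face_def)

text \<open>In the triangulated prism, the \<open>k\<close>-th simplex has its vertices \<open>0, \<dots>, k\<close> at time 1 and
  the remaining ones at time 0.\<close>

definition prism_simplex ::
    "nat \<Rightarrow> nat \<Rightarrow> (real \<times> 'a \<Rightarrow> 'b) \<Rightarrow> ((nat \<Rightarrow> real) \<Rightarrow> 'a) \<Rightarrow> (nat \<Rightarrow> real) \<Rightarrow> 'b" where
  "prism_simplex q k H f =
     restrict (\<lambda>x. H (\<Sum>i<Suc k. x i, f (degeneracy k x))) (standard_simplex (Suc q))"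

definition prism_F2 :: "nat \<Rightarrow> (real \<times> 'a \<Rightarrow> 'b) \<Rightarrow> 'a chain_F2 \<Rightarrow> 'b chain_F2" where
  "prism_F2 q H = extend_F2 (\<lambda>f. \<Sum>k\<le>q. gen_F2 (prism_simplex q k H f))"

lemma singular_simplex_prism_simplex:
  assumes f: "singular_simplex q X f" and "k \<le> q"
    and H: "continuous_map (prod_topology (top_of_set {0..1}) X) Y H"
  shows "singular_simplex (Suc q) Y (prism_simplex q k H f)"
proof -
  let ?D = "\<lambda>p. subtopology (powertop_real UNIV) (standard_simplex p)"
  have proj: "continuous_map (?D (Suc q)) euclideanreal (\<lambda>x. x i)" for i
    by (intro continuous_map_from_subtopology continuous_map_product_projection) simp
  have "continuous_map (?D (Suc q)) (top_of_set {0..1}) (\<lambda>x. \<Sum>i<Suc k. x i)"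
    using sum_standard_simplex_01 [of _ "Suc q" "Suc k"]
    by (auto simp: continuous_map_in_subtopology simp del: sum.lessThan_Suc
        intro!: continuous_map_sum proj)
  moreover have "continuous_map (?D (Suc q)) (?D q) (degeneracy k)"
    using \<open>k \<le> q\<close>
    by (auto simp: continuous_map_in_subtopology continuous_map_componentwise_UNIV
        degeneracy_in_standard_simplex)
      (auto simp: degeneracy_def intro!: proj continuous_map_add)
  then have "continuous_map (?D (Suc q)) X (f \<circ> degeneracy k)"
    using f by (auto simp: singular_simplex_def intro: continuous_map_compose)
  ultimately have "continuous_map (?D (Suc q)) Y
      (H \<circ> (\<lambda>x. (\<Sum>i<Suc k. x i, (f \<circ> degeneracy k) x)))"
    by (intro continuous_map_compose [OF _ H] continuous_map_pairedI)
  then show ?thesis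
    by (auto simp: singular_simplex_def prism_simplex_def o_def
        elim: continuous_map_eq simp del: sum.lessThan_Suc)
qed

lemma prism_F2_in_chains:
  assumes "c \<in> chains_F2 q X" "continuous_map (prod_topology (top_of_set {0..1}) X) Y H"
  shows "prism_F2 q H c \<in> chains_F2 (Suc q) Y"
  unfolding prism_F2_def
  by (rule extend_F2_in_chains [OF assms(1)])
    (auto intro!: chains_F2_sum simp: gen_F2_in_chains
      singular_simplex_prism_simplex [OF _ _ assms(2)] simp del: sum.atMost_Suc)

text \<open>Vertex \<open>j\<close> of \<open>f\<close> occurs only once, at time 1; dropping it
  leaves one vertex fewer at time 1, hence \<open>k - 1\<close>.\<close>

lemma prism_simplex_face_less:
  assumes "j < k" "k \<le> Suc q"
  shows "singular_face (Suc (Suc q)) j (prism_simplex (Suc q) k H f) =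
    prism_simplex q (k - 1) H (singular_face (Suc q) j f)"
proof -
  obtain l where k: "k = Suc l"
    using assms by (cases k) auto
  have "degeneracy l x \<in> standard_simplex q" if "x \<in> standard_simplex (Suc q)" for x
    using that assms k by (auto intro: degeneracy_in_standard_simplex)
  moreover have "simplical_face j x \<in> standard_simplex (Suc (Suc q))"
    if "x \<in> standard_simplex (Suc q)" for x :: "nat \<Rightarrow> real"
    using that assms by (auto intro: simplical_face_in_standard_simplex)
  ultimately show ?thesis
    using assms unfolding prism_simplex_def singular_face_def k
    by (auto simp: fun_eq_iff restrict_def degeneracy_simplical_face_less sum_simplical_face
        simp del: sum.lessThan_Suc)
qed

text \<open>Here vertex \<open>j\<close> lies at time 0 over vertex \<open>j - 1\<close> of
  \<open>f\<close>, which occurs nowhere else; the vertices at time 1 remain.\<close>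

lemma prism_simplex_face_greater:
  assumes "Suc k < j" "j \<le> Suc (Suc q)"
  shows "singular_face (Suc (Suc q)) j (prism_simplex (Suc q) k H f) =
    prism_simplex q k H (singular_face (Suc q) (j - 1) f)"
proof -
  have "degeneracy k x \<in> standard_simplex q" if "x \<in> standard_simplex (Suc q)" for x
    using that assms by (auto intro: degeneracy_in_standard_simplex)
  moreover have "simplical_face j x \<in> standard_simplex (Suc (Suc q))"
    if "x \<in> standard_simplex (Suc q)" for x :: "nat \<Rightarrow> real"
    using that assms by (auto intro: simplical_face_in_standard_simplex)
  ultimately show ?thesis
    using assms unfolding prism_simplex_def singular_face_def
    by (auto simp: fun_eq_iff restrict_def degeneracy_simplical_face_greater sum_simplical_face
        simp del: sum.lessThan_Suc)
qed

text \<open>The wall between the prism simplices \<open>k - 1\<close> and \<open>k\<close>; the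
  slices \<open>0\<close> and \<open>Suc q\<close> are the two ends of the prism.\<close>

definition prism_slice ::
    "nat \<Rightarrow> nat \<Rightarrow> (real \<times> 'a \<Rightarrow> 'b) \<Rightarrow> ((nat \<Rightarrow> real) \<Rightarrow> 'a) \<Rightarrow> (nat \<Rightarrow> real) \<Rightarrow> 'b" where
  "prism_slice q k H f = restrict (\<lambda>x. H (\<Sum>i<k. x i, f x)) (standard_simplex q)"

text \<open>The degeneracy undoes these two faces. The slice depends on \<open>j\<close> and not on
  \<open>k\<close>, so neighbouring prism simplices share a wall.\<close>

lemma prism_simplex_face_same:
  assumes "j = k \<or> j = Suc k" "k \<le> q"
  shows "singular_face (Suc q) j (prism_simplex q k H f) = prism_slice q j H f"
proof -
  have "simplical_face j x \<in> standard_simplex (Suc q)"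
    if "x \<in> standard_simplex q" for x :: "nat \<Rightarrow> real"
    using that assms by (intro simplical_face_in_standard_simplex) auto
  then show ?thesis
    using assms unfolding prism_simplex_def singular_face_def prism_slice_def
    by (auto simp: fun_eq_iff restrict_def degeneracy_simplical_face_same [OF assms(1)]
        sum_simplical_face simp del: sum.lessThan_Suc)
qed

lemma prism_slice_0: "prism_slice q 0 H f = simplex_map q (\<lambda>x. H (0, x)) f"
  by (auto simp: prism_slice_def simplex_map_def)

lemma prism_slice_Suc: "prism_slice q (Suc q) H f = simplex_map q (\<lambda>x. H (1, x)) f"
  by (auto simp: prism_slice_def simplex_map_def fun_eq_iff restrict_def lessThan_Suc_atMost
      sum_standard_simplex)

text \<open>The inner terms occur twice and cancel modulo 2.\<close>

lemma telescope_F2: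
  "(\<Sum>k\<le>n. g k) + (\<Sum>k\<le>n. g (Suc k)) = (g 0 + g (Suc n) :: 'a \<Rightarrow>\<^sub>0 bit)"
  unfolding sum.distrib [symmetric]
  by (induction n) (simp_all add: add.assoc add_self_left_F2)

text \<open>The faces \<open>k\<close> and \<open>k + 1\<close> of the \<open>k\<close>-th simplex are consecutive slices, whose sum
  telescopes to the two ends; the other faces triangulate the prism over the boundary.\<close>

lemma boundary_prism_simplex:
  fixes H :: "real \<times> 'a \<Rightarrow> 'b"
  shows "(\<Sum>k\<le>q. \<Sum>j\<le>Suc q. gen_F2 (singular_face (Suc q) j (prism_simplex q k H f))) =
    prism_F2 (q - 1) H (boundary_F2 q (gen_F2 f)) +
    (gen_F2 (simplex_map q (\<lambda>x. H (0, x)) f) + gen_F2 (simplex_map q (\<lambda>x. H (1, x)) f))"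
proof -
  let ?d = "\<lambda>k j. gen_F2 (singular_face (Suc q) j (prism_simplex q k H f))"
  \<comment> \<open>\<open>?L\<close> and \<open>?U\<close> index the lateral faces, which drop a
    vertex of \<open>f\<close> at time 1 and at time 0 respectively.\<close>
  let ?L = "{(k, j). j < k \<and> k \<le> q}" and ?U = "{(k, j). Suc k < j \<and> j \<le> Suc q}"
  have fin: "finite ?L" "finite ?U"
    by (rule finite_subset [of _ "{..q} \<times> {..Suc q}"], auto)+
  have row: "(\<Sum>j\<le>Suc q. ?d k j) =
      (\<Sum>j<k. ?d k j) + (\<Sum>j\<in>{Suc k<..Suc q}. ?d k j) +
      (gen_F2 (prism_slice q k H f) + gen_F2 (prism_slice q (Suc k) H f))" if "k \<le> q" for k
  proof -
    have "{..Suc q} = insert k (insert (Suc k) ({..<k} \<union> {Suc k<..Suc q}))"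
      using that by auto
    moreover have "sum (?d k) ({..<k} \<union> {Suc k<..Suc q}) =
        (\<Sum>j<k. ?d k j) + (\<Sum>j\<in>{Suc k<..Suc q}. ?d k j)"
      by (rule sum.union_disjoint) auto
    ultimately have "sum (?d k) {..Suc q} = ?d k k + (?d k (Suc k) +
        ((\<Sum>j<k. ?d k j) + (\<Sum>j\<in>{Suc k<..Suc q}. ?d k j)))"
      by simp
    then show ?thesis
      using that by (simp add: prism_simplex_face_same ac_simps)
  qed
  have lower: "(\<Sum>k\<le>q. \<Sum>j<k. ?d k j) = (\<Sum>(k, j)\<in>?L. ?d k j)"
    by (subst sum.Sigma) (auto intro!: sum.cong)
  have upper: "(\<Sum>k\<le>q. \<Sum>j\<in>{Suc k<..Suc q}. ?d k j) = (\<Sum>(k, j)\<in>?U. ?d k j)"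
    by (subst sum.Sigma) (auto intro!: sum.cong)
  have "(\<Sum>(k, j)\<in>?L. ?d k j) + (\<Sum>(k, j)\<in>?U. ?d k j) =
      prism_F2 (q - 1) H (boundary_F2 q (gen_F2 f))"
  proof (cases q)
    \<comment> \<open>In degree 0 the truncated \<open>q - 1\<close> does no harm: it applies to a
      zero boundary, and there are no lateral faces.\<close>
    case 0
    then have "?L = {}" "?U = {}"
      by auto
    then show ?thesis
      using 0 by (simp only: sum.empty boundary_F2_0 prism_F2_def extend_F2_0 add_0)
  next
    case (Suc p)
    let ?e = "\<lambda>j k. gen_F2 (prism_simplex p k H (singular_face (Suc p) j f))"
    \<comment> \<open>The face of \<open>f\<close> becomes the outer index; the reindexed ranges
      \<open>j <= k\<close> and \<open>k < j\<close> tile the full rectangle of face and prism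
      indices.\<close>
    have "(\<Sum>(k, j)\<in>?L. ?d k j) = (\<Sum>(j, k)\<in>{(j, k). j \<le> k \<and> k \<le> p}. ?e j k)"
      by (rule sum.reindex_bij_witness [where i = "\<lambda>(j, k). (Suc k, j)" and j = "\<lambda>(k, j). (j, k - 1)"])
        (auto simp: Suc prism_simplex_face_less)
    moreover have "(\<Sum>(k, j)\<in>?U. ?d k j) = (\<Sum>(j, k)\<in>{(j, k). k < j \<and> j \<le> Suc p}. ?e j k)"
      by (rule sum.reindex_bij_witness [where i = "\<lambda>(j, k). (k, Suc j)" and j = "\<lambda>(k, j). (j - 1, k)"])
        (auto simp: Suc prism_simplex_face_greater)
    moreover have "(\<Sum>(j, k)\<in>{(j, k). j \<le> k \<and> k \<le> p} \<union> {(j, k). k < j \<and> j \<le> Suc p}. ?e j k) =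
        (\<Sum>(j, k)\<in>{(j, k). j \<le> k \<and> k \<le> p}. ?e j k) +
        (\<Sum>(j, k)\<in>{(j, k). k < j \<and> j \<le> Suc p}. ?e j k)"
    proof (rule sum.union_disjoint)
      show "finite {(j, k). j \<le> k \<and> k \<le> p}" "finite {(j, k). k < j \<and> j \<le> Suc p}"
        by (rule finite_subset [of _ "{..Suc p} \<times> {..p}"], auto)+
    qed auto
    moreover have "{(j, k). j \<le> k \<and> k \<le> p} \<union> {(j, k). k < j \<and> j \<le> Suc p} = {..Suc p} \<times> {..p}"
      by auto
    ultimately have "(\<Sum>(k, j)\<in>?L. ?d k j) + (\<Sum>(k, j)\<in>?U. ?d k j) = (\<Sum>j\<le>Suc p. \<Sum>k\<le>p. ?e j k)"
      by (simp only: sum.cartesian_product)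
    then show ?thesis
      unfolding Suc boundary_F2_Suc prism_F2_def extend_F2_sum extend_F2_gen by simp
  qed
  then show ?thesis
    using telescope_F2 [of "\<lambda>k. gen_F2 (prism_slice q k H f)" q]
    by (simp add: row sum.distrib lower upper prism_slice_0 prism_slice_Suc del: sum.atMost_Suc)
qed

text \<open>The chain homotopy relation without signs, extended linearly from single
  simplices.\<close>

proposition boundary_prism_F2:
  "boundary_F2 (Suc q) (prism_F2 q H c) =
    prism_F2 (q - 1) H (boundary_F2 q c) +
    (chain_map_F2 q (\<lambda>x. H (0, x)) c + chain_map_F2 q (\<lambda>x. H (1, x)) c)"
proof -
  have "boundary_F2 q c = extend_F2 (\<lambda>f. boundary_F2 q (gen_F2 f)) c" for c :: "'b chain_F2"
    by (cases q) (simp_all add: boundary_F2_0 boundary_F2_Suc extend_F2_def)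
  then have *: "prism_F2 (q - 1) H (boundary_F2 q c) =
      extend_F2 (\<lambda>f. prism_F2 (q - 1) H (boundary_F2 q (gen_F2 f))) c"
    unfolding prism_F2_def by (metis extend_F2_extend)
  have "boundary_F2 (Suc q) (prism_F2 q H c) = extend_F2 (\<lambda>f.
      \<Sum>k\<le>q. \<Sum>j\<le>Suc q. gen_F2 (singular_face (Suc q) j (prism_simplex q k H f))) c"
    unfolding boundary_F2_Suc prism_F2_def extend_F2_extend extend_F2_sum extend_F2_gen ..
  then show ?thesis
    unfolding boundary_prism_simplex extend_F2_plus * chain_map_F2_def .
qed

section \<open>Homology of deformation retracts\<close>

lemma comm_group_cycle_group_F2: "comm_group (cycle_group_F2 q X)"
  by (rule comm_groupI)
    (auto simp: cycle_group_F2_def chains_F2_add boundary_F2_add add.assoc add.commute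
      intro: add_self_F2)

lemma inv_cycle_group_F2:
  assumes "c \<in> carrier (cycle_group_F2 q X)"
  shows "inv\<^bsub>cycle_group_F2 q X\<^esub> c = c"
proof -
  interpret comm_group "cycle_group_F2 q X"
    by (rule comm_group_cycle_group_F2)
  show ?thesis
    by (rule inv_equality) (use assms in \<open>auto simp: cycle_group_F2_def add_self_F2\<close>)
qed

lemma subgroup_boundaries_F2: "subgroup (boundaries_F2 q X) (cycle_group_F2 q X)"
proof
  show sub: "boundaries_F2 q X \<subseteq> carrier (cycle_group_F2 q X)"
    by (auto simp: boundaries_F2_def cycle_group_F2_def boundary_F2_in_chains boundary_boundary_F2)
  show "\<one>\<^bsub>cycle_group_F2 q X\<^esub> \<in> boundaries_F2 q X"
    by (auto simp: boundaries_F2_def cycle_group_F2_def image_iff intro!: bexI [of _ 0])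
  show "inv\<^bsub>cycle_group_F2 q X\<^esub> c \<in> boundaries_F2 q X" if "c \<in> boundaries_F2 q X" for c
    using that sub by (auto simp: inv_cycle_group_F2)
  show "c \<otimes>\<^bsub>cycle_group_F2 q X\<^esub> d \<in> boundaries_F2 q X"
    if "c \<in> boundaries_F2 q X" "d \<in> boundaries_F2 q X" for c d
    using that by (auto simp: boundaries_F2_def cycle_group_F2_def chains_F2_add
        simp flip: boundary_F2_add)
qed

lemma normal_boundaries_F2: "boundaries_F2 q X \<lhd> cycle_group_F2 q X"
  using comm_group.subgroup_imp_normal [OF comm_group_cycle_group_F2 subgroup_boundaries_F2] .

lemma comm_group_homology_group_F2: "comm_group (homology_group_F2 q X)"
  unfolding homology_group_F2_def
  by (rule comm_group.abelian_FactGroup [OF comm_group_cycle_group_F2 subgroup_boundaries_F2])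

text \<open>First isomorphism theorem for the map taking a cycle of \<open>T\<close> to its class in
  \<open>S\<close>: its kernel consists of the boundaries of \<open>T\<close>, and it is
  onto.\<close>

theorem homology_group_F2_deformation_retract:
  assumes "deformation_retracts_onto S T"
  shows "homology_group_F2 q (top_of_set S) \<cong> homology_group_F2 q (top_of_set T)"
proof -
  obtain g where g_ret: "retraction S T g"
    and "homotopic_with_canon (\<lambda>f. \<forall>x\<in>T. f x = x) S S id g"
    using assms unfolding deformation_retracts_onto_def by blast
  \<comment> \<open>The endpoint equations of \<open>homotopic_with\<close> hold at all points, also
    outside \<open>S\<close>, so they can rewrite inside the chain maps.\<close>
  then obtain H
    where H: "continuous_map (prod_topology (top_of_set {0..1::real}) (top_of_set S)) (top_of_set S) H"
    and H0: "\<And>x. H (0, x) = x" and H1: "\<And>x. H (1, x) = g x"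
    unfolding homotopic_with_def id_apply by blast
  have "T \<subseteq> S" and g: "continuous_map (top_of_set S) (top_of_set T) g"
    and g_id: "\<And>x. x \<in> T \<Longrightarrow> g x = x"
    using g_ret by (auto simp: retraction_def)
  let ?S = "top_of_set S" and ?T = "top_of_set T"
  let ?ZS = "cycle_group_F2 q ?S" and ?ZT = "cycle_group_F2 q ?T"
  let ?BS = "boundaries_F2 q ?S" and ?BT = "boundaries_F2 q ?T"
  let ?HS = "homology_group_F2 q ?S"
  let ?h = "\<lambda>c. ?BS #>\<^bsub>?ZS\<^esub> c"
  interpret ZS: comm_group ?ZS
    by (rule comm_group_cycle_group_F2)
  interpret ZT: comm_group ?ZT
    by (rule comm_group_cycle_group_F2)
  interpret HS: comm_group ?HS
    by (rule comm_group_homology_group_F2)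
  interpret HT: comm_group "homology_group_F2 q ?T"
    by (rule comm_group_homology_group_F2)
  have chains: "chains_F2 p ?T \<subseteq> chains_F2 p ?S" for p
    using \<open>T \<subseteq> S\<close> by (rule chains_F2_mono)
  have ZT_ZS: "carrier ?ZT \<subseteq> carrier ?ZS"
    using chains by (auto simp: cycle_group_F2_def)
  have BT_BS: "?BT \<subseteq> ?BS"
    using chains by (auto simp: boundaries_F2_def)
  have "?h \<in> hom ?ZS ?HS"
    unfolding homology_group_F2_def by (rule normal.r_coset_hom_Mod [OF normal_boundaries_F2])
  \<comment> \<open>Both groups add chains of the same type, so the class map restricts to the
    cycles of \<open>T\<close>.\<close>
  moreover have "mult ?ZT = mult ?ZS"
    by (simp add: cycle_group_F2_def)
  ultimately have "?h \<in> hom ?ZT ?HS"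
    using ZT_ZS by (simp add: hom_def Pi_iff subset_iff)
  then interpret h: group_hom ?ZT ?HS ?h
    by unfold_locales
  have g_homologous: "chain_map_F2 q g c \<in> carrier ?ZT" "c + chain_map_F2 q g c \<in> ?BS"
    if "c \<in> carrier ?ZS" for c
  proof -
    have c: "c \<in> chains_F2 q ?S" "boundary_F2 q c = 0"
      using that by (auto simp: cycle_group_F2_def)
    have "boundary_F2 q (chain_map_F2 q g c) = 0"
      using c(2) by (cases q) (simp_all add: boundary_F2_0 boundary_chain_map_F2,
        simp add: chain_map_F2_def)
    then show "chain_map_F2 q g c \<in> carrier ?ZT"
      using chain_map_F2_in_chains [OF c(1) g] by (simp add: cycle_group_F2_def)
    \<comment> \<open>As \<open>c\<close> is a cycle, the prism over its boundary drops out; modulo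
      2 the remaining sum is the difference of \<open>c\<close> and its image.\<close>
    have "boundary_F2 (Suc q) (prism_F2 q H c) = c + chain_map_F2 q g c"
      unfolding boundary_prism_F2 H0 H1 c(2)
      using chain_map_F2_id [OF c(1), of "\<lambda>x. x"] by (simp add: prism_F2_def)
    then show "c + chain_map_F2 q g c \<in> ?BS"
      unfolding boundaries_F2_def using prism_F2_in_chains [OF c(1) H] by (metis image_eqI)
  qed
  have "kernel ?ZT ?HS ?h = ?BT"
  proof (intro equalityI subsetI)
    fix c
    assume "c \<in> kernel ?ZT ?HS ?h"
    then have c: "c \<in> carrier ?ZT" "?h c = ?BS"
      by (auto simp: kernel_def homology_group_F2_def)
    then have "c \<in> ?BS"
      using ZS.coset_join1 ZT_ZS subgroup_boundaries_F2 by blast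
    then obtain b where b: "b \<in> chains_F2 (Suc q) ?S" "c = boundary_F2 (Suc q) b"
      by (auto simp: boundaries_F2_def)
    \<comment> \<open>\<open>g\<close> fixes \<open>T\<close> and hence \<open>c\<close>, while it
      carries the bounding chain \<open>b\<close> from \<open>S\<close> into
      \<open>T\<close>.\<close>
    have "c = chain_map_F2 q g c"
      using c(1) g_id chain_map_F2_id [of c q ?T g] by (simp add: cycle_group_F2_def)
    also have "\<dots> = boundary_F2 (Suc q) (chain_map_F2 (Suc q) g b)"
      by (simp add: b(2) boundary_chain_map_F2)
    finally show "c \<in> ?BT"
      using chain_map_F2_in_chains [OF b(1) g] by (auto simp: boundaries_F2_def)
  next
    fix c
    assume "c \<in> ?BT"
    moreover have "c \<in> carrier ?ZT"
      using \<open>c \<in> ?BT\<close> subgroup.subset [OF subgroup_boundaries_F2] by blast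
    ultimately show "c \<in> kernel ?ZT ?HS ?h"
      using BT_BS ZT_ZS ZS.coset_join2 [of c ?BS] subgroup_boundaries_F2
      by (auto simp: kernel_def homology_group_F2_def)
  qed
  moreover have "?h ` carrier ?ZT = carrier ?HS"
  proof
    show "?h ` carrier ?ZT \<subseteq> carrier ?HS"
      using h.hom_closed by blast
    have "?h c = ?h (chain_map_F2 q g c)" if "c \<in> carrier ?ZS" for c
    proof (rule ZS.repr_independence [OF _ that subgroup_boundaries_F2])
      \<comment> \<open>Adding the boundary \<open>c + chain_map_F2 q g c\<close> to
        \<open>c\<close> gives the image, as the two copies of \<open>c\<close> cancel.\<close>
      show "chain_map_F2 q g c \<in> ?h c"
        using g_homologous(2) [OF that]
        by (simp add: r_coset_def cycle_group_F2_def) (metis add.commute add_self_left_F2)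
    qed
    then show "carrier ?HS \<subseteq> ?h ` carrier ?ZT"
      using g_homologous(1) unfolding homology_group_F2_def carrier_FactGroup by blast
  qed
  ultimately have "homology_group_F2 q ?T \<cong> ?HS"
    using h.FactGroup_iso_set unfolding homology_group_F2_def [of q ?T]
    by (metis is_isoI)
  then show ?thesis
    by (rule HT.iso_sym)
qed

section \<open>Invariance of the rank under isomorphism\<close>

lemma hom_finprod:
  assumes "comm_monoid G" "comm_monoid H" "h \<in> hom G H" "h \<one>\<^bsub>G\<^esub> = \<one>\<^bsub>H\<^esub>"
    and "f \<in> A \<rightarrow> carrier G"
  shows "h (finprod G f A) = finprod H (\<lambda>x. h (f x)) A"
proof -
  interpret G: comm_monoid G by fact
  interpret H: comm_monoid H by fact
  have h: "h x \<in> carrier H" if "x \<in> carrier G" for x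
    using assms(3) that by (auto simp: hom_def)
  show ?thesis
    using assms(5)
  proof (induction A rule: infinite_finite_induct)
    case (insert a A)
    then have "f \<in> A \<rightarrow> carrier G" "f a \<in> carrier G"
      by auto
    moreover have "(\<lambda>x. h (f x)) \<in> A \<rightarrow> carrier H" "h (f a) \<in> carrier H"
      using insert.prems h by auto
    ultimately show ?case
      using insert hom_mult [OF assms(3)] by simp
  \<comment> \<open>\<open>finprod\<close> is one for empty and infinite sets, and
    \<open>hom\<close> alone does not make \<open>h\<close> preserve one.\<close>
  qed (simp_all add: assms(4))
qed

text \<open>A trivial product over a finite subset of the image pulls back to a trivial product over
  a subset of \<open>S\<close>, since \<open>h\<close> is injective.\<close>

lemma independent_F2_iso:
  assumes G: "comm_group G" and H: "comm_group H" and h: "h \<in> iso G H"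
    and S: "independent_F2 G S"
  shows "independent_F2 H (h ` S)"
proof -
  interpret G: comm_group G by fact
  interpret H: comm_group H by fact
  have hom: "h \<in> hom G H" and bij: "bij_betw h (carrier G) (carrier H)"
    using h by (auto simp: iso_def)
  have one: "h \<one>\<^bsub>G\<^esub> = \<one>\<^bsub>H\<^esub>"
    using hom by (rule hom_one) (rule G.is_group H.is_group)+
  have S_sub: "S \<subseteq> carrier G"
    using S by (simp add: independent_F2_def)
  have "T = {}" if T: "finite T" "T \<subseteq> h ` S" "finprod H (\<lambda>x. x) T = \<one>\<^bsub>H\<^esub>" for T
  proof -
    obtain U where U: "U \<subseteq> S" "inj_on h U" "T = h ` U"
      using T(2) by (meson subset_image_inj)
    have "finite U"
      using U T(1) finite_imageD by blast
    have U_sub: "U \<subseteq> carrier G"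
      using U(1) S_sub by blast
    then have "h ` U \<subseteq> carrier H"
      using hom by (auto simp: hom_def)
    then have "finprod H (\<lambda>x. x) T = finprod H h U"
      unfolding U(3) using U(2) by (intro H.finprod_reindex) auto
    also have "\<dots> = h (finprod G (\<lambda>x. x) U)"
      using U_sub
      by (intro hom_finprod [OF G.comm_monoid_axioms H.comm_monoid_axioms hom one, symmetric]) auto
    finally have "h (finprod G (\<lambda>x. x) U) = finprod H (\<lambda>x. x) T" ..
    then have "h (finprod G (\<lambda>x. x) U) = h \<one>\<^bsub>G\<^esub>"
      by (simp add: T(3) one)
    moreover have "finprod G (\<lambda>x. x) U \<in> carrier G"
      using U_sub by (intro G.finprod_closed) auto
    ultimately have "finprod G (\<lambda>x. x) U = \<one>\<^bsub>G\<^esub>"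
      using bij by (auto simp: bij_betw_def dest: inj_onD)
    then have "U = {}"
      using S \<open>finite U\<close> U(1) by (auto simp: independent_F2_def)
    then show ?thesis
      using U(3) by simp
  qed
  moreover have "h ` S \<subseteq> carrier H"
    using S_sub hom by (auto simp: hom_def)
  ultimately show ?thesis
    by (simp add: independent_F2_def)
qed

lemma rank_F2_iso_le:
  assumes G: "comm_group G" and H: "comm_group H" and "G \<cong> H"
  shows "rank_F2 G \<le> rank_F2 H"
proof -
  obtain h where h: "h \<in> iso G H"
    using \<open>G \<cong> H\<close> by (auto simp: is_iso_def)
  have "enat (card S) \<le> rank_F2 H" if S: "finite S" "independent_F2 G S" for S
  proof -
    have "inj_on h S"
      using h S(2) by (auto simp: iso_def bij_betw_def independent_F2_def intro: inj_on_subset)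
    then have "card S = card (h ` S)"
      by (simp add: card_image)
    then show ?thesis
      unfolding rank_F2_def
      using S independent_F2_iso [OF G H h S(2)] by (intro Sup_upper) auto
  qed
  then show ?thesis
    unfolding rank_F2_def [of G] by (intro Sup_least) auto
qed

lemma rank_F2_iso:
  assumes "comm_group G" "comm_group H" "G \<cong> H"
  shows "rank_F2 G = rank_F2 H"
  using assms group.iso_sym [OF comm_group.axioms(2)] rank_F2_iso_le by (metis order_antisym)

section \<open>The nearest point projection\<close>

lemma offset_nonempty:
  assumes "D \<noteq> {}" "0 \<le> r"
  shows "offset D r = {x. infdist x D \<le> r}"
  using assms by (auto simp: offset_def rho_def)

lemma nearest_point_iff:
  "nearest_point D x p \<longleftrightarrow> p \<in> D \<and> dist x p = infdist x D"
  unfolding nearest_point_def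
  by (metis antisym empty_iff infdist_le infdist_notempty cINF_greatest)

text \<open>A supremum above \<open>r\<close> forces an admissible radius above \<open>r\<close>, so
  the closed offset lies inside an open neighbourhood with unique nearest points.\<close>

lemma less_reach_obtains:
  assumes "ennreal r < reach D" "D \<noteq> {}" "0 \<le> r"
  obtains s where "r < s" "\<And>x. infdist x D < s \<Longrightarrow> \<exists>!p. nearest_point D x p"
proof -
  obtain s where "ennreal r < ennreal s" "0 < s"
    "\<And>x. rho D x < ennreal s \<Longrightarrow> \<exists>!p. nearest_point D x p"
    using assms(1) unfolding reach_def less_Sup_iff by blast
  then show thesis
    using assms(2,3) by (intro that [of s]) (auto simp: rho_def ennreal_less_iff infdist_nonneg)
qed

text \<open>Points of \<open>D\<close> away from \<open>p x\<close> are farther from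
  \<open>x\<close> than \<open>p x\<close> by a definite gap; for \<open>y\<close> near
  \<open>x\<close> they cannot be nearest to \<open>y\<close>.\<close>

lemma continuous_on_unique_nearest_point:
  fixes D :: "'a::heine_borel set"
  assumes "closed D"
    and near: "\<And>x. x \<in> S \<Longrightarrow> nearest_point D x (p x)"
    and uniq: "\<And>x q. x \<in> S \<Longrightarrow> nearest_point D x q \<Longrightarrow> q = p x"
  shows "continuous_on S p"
  unfolding continuous_on_iff
proof (intro ballI allI impI)
  fix x e :: _
  assume x: "x \<in> S" and e: "0 < (e :: real)"
  let ?K = "D - ball (p x) e"
  show "\<exists>d>0. \<forall>y\<in>S. dist y x < d \<longrightarrow> dist (p y) (p x) < e"
  proof (cases "?K = {}")
    \<comment> \<open>Kept apart because \<open>infdist x {}\<close> is 0, so the gap argument would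
      fail.\<close>
    case True
    have "dist (p y) (p x) < e" if "y \<in> S" for y
      using near [OF that] True by (auto simp: nearest_point_def dist_commute)
    then show ?thesis
      by (intro exI [of _ 1]) auto
  next
    case False
    have "closed ?K"
      using \<open>closed D\<close> by auto
    then obtain k where k: "k \<in> ?K" "infdist x ?K = dist x k"
      using False infdist_attains_inf by metis
    have "k \<noteq> p x"
      using k(1) e by auto
    then have "\<not> nearest_point D x k"
      using uniq [OF x] by blast
    \<comment> \<open>Without a gap, the point \<open>k\<close> attaining the distance to
      \<open>?K\<close> would be a second nearest point.\<close>
    then have gap: "infdist x D < infdist x ?K"
      using k infdist_le [of k D x] by (auto simp: nearest_point_iff)
    \<comment> \<open>Halved, as \<open>dist y x\<close> is spent twice: in the triangle inequality
      and in the Lipschitz bound for the distance to \<open>D\<close>.\<close>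
    define d where "d = (infdist x ?K - infdist x D) / 2"
    have "dist (p y) (p x) < e" if y: "y \<in> S" "dist y x < d" for y
    proof (rule ccontr)
      assume "\<not> dist (p y) (p x) < e"
      then have "p y \<in> ?K"
        using near [OF y(1)] by (auto simp: nearest_point_def dist_commute)
      then have "infdist x ?K \<le> dist x (p y)"
        by (rule infdist_le)
      also have "\<dots> \<le> dist y x + dist y (p y)"
        by (metis dist_commute dist_triangle)
      also have "dist y (p y) = infdist y D"
        using near [OF y(1)] by (simp add: nearest_point_iff)
      also have "\<dots> \<le> infdist x D + dist y x"
        by (rule infdist_triangle)
      finally show False
        using y(2) by (simp add: d_def)
    qed
    then show ?thesis
      using gap by (intro exI [of _ d]) (auto simp: d_def)
  qed
qed

lemma deformation_retracts_onto_offset: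
  fixes D :: "'a::euclidean_space set"
  assumes "closed D" "0 \<le> r" "ennreal r < reach D"
  shows "deformation_retracts_onto (offset D r) D"
proof (cases "D = {}")
  \<comment> \<open>The distance to the empty set is infinite, so its offset is empty too.\<close>
  case True
  then have "offset D r = {}"
    by (auto simp: offset_def rho_def top_unique)
  then show ?thesis
    using True by (auto simp: deformation_retracts_onto_def retraction_def intro!: exI [of _ id])
next
  case False
  let ?S = "offset D r"
  have S: "?S = {x. infdist x D \<le> r}"
    using False \<open>0 \<le> r\<close> by (rule offset_nonempty)
  obtain s where "r < s" "\<And>x. infdist x D < s \<Longrightarrow> \<exists>!p. nearest_point D x p"
    using less_reach_obtains assms False by metis
  then have ex1: "\<exists>!p. nearest_point D x p" if "x \<in> ?S" for x
    using that by (auto simp: S)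
  define p where "p x = (THE p. nearest_point D x p)" for x
  have near: "nearest_point D x (p x)" if "x \<in> ?S" for x
    unfolding p_def using theI' [OF ex1 [OF that]] .
  have uniq: "q = p x" if "x \<in> ?S" "nearest_point D x q" for x q
    using ex1 near that by blast
  have "D \<subseteq> ?S"
    using \<open>0 \<le> r\<close> by (auto simp: S)
  have p_id: "p x = x" if "x \<in> D" for x
    using uniq [of x x] that \<open>D \<subseteq> ?S\<close> by (auto simp: nearest_point_iff)
  have contp: "continuous_on ?S p"
    using continuous_on_unique_nearest_point \<open>closed D\<close> near uniq by blast
  have "retraction ?S D p"
    using \<open>D \<subseteq> ?S\<close> contp near p_id by (auto simp: retraction_def nearest_point_def)
  moreover have "homotopic_with_canon (\<lambda>f. \<forall>x\<in>D. f x = x) ?S ?S id p"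
    unfolding homotopic_with_def
  proof (intro exI conjI ballI allI)
    let ?H = "\<lambda>(t, x). (1 - t) *\<^sub>R x + t *\<^sub>R p x"
    have "?H (t, x) \<in> ?S" if "t \<in> {0..1}" "x \<in> ?S" for t x
    proof -
      have p: "p x \<in> D" "dist x (p x) \<le> r"
        using near [OF that(2)] that(2) by (auto simp: nearest_point_iff S)
      \<comment> \<open>The distance of the moved point to \<open>D\<close> is at most its distance
        to \<open>p x\<close>, which shrinks by the factor \<open>1 - t\<close>.\<close>
      have "(1 - t) *\<^sub>R x + t *\<^sub>R p x - p x = (1 - t) *\<^sub>R (x - p x)"
        by (simp add: algebra_simps)
      then have "dist ((1 - t) *\<^sub>R x + t *\<^sub>R p x) (p x) = (1 - t) * dist x (p x)"
        using that(1) by (simp add: dist_norm)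
      also have "\<dots> \<le> 1 * r"
        using that(1) p(2) by (intro mult_mono) auto
      finally show ?thesis
        using infdist_le2 [OF p(1)] by (auto simp: S)
    qed
    moreover have "continuous_on ({0..1} \<times> ?S) ?H"
      unfolding case_prod_unfold
      by (intro continuous_intros continuous_on_compose2 [OF contp]) auto
    ultimately show "continuous_map (prod_topology (top_of_set {0..1}) (top_of_set ?S)) (top_of_set ?S) ?H"
      by (auto simp: simp flip: subtopology_Times)
  \<comment> \<open>On \<open>D\<close> the projection is the identity, so the segment is constant
    and points stay fixed at all times.\<close>
  qed (auto simp: p_id algebra_simps)
  ultimately show ?thesis
    unfolding deformation_retracts_onto_def by blast
qed

theorem theorem3p3:
  fixes D :: "(real ^ 2) set" and r :: real
  assumes "closed D" and "reach D > 0"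
    and "0 \<le> r" and "ennreal r < reach D"
  shows "deformation_retracts_onto (offset D r) D \<and>
    (\<forall>q \<in> {0, 1}.
       homology_group_F2 q (top_of_set (offset D r)) \<cong> homology_group_F2 q (top_of_set D) \<and>
       betti_F2 q (top_of_set (offset D r)) = betti_F2 q (top_of_set D))"
proof -
  have retract: "deformation_retracts_onto (offset D r) D"
    using assms by (intro deformation_retracts_onto_offset)
  then show ?thesis
    unfolding betti_F2_def
    by (simp add: homology_group_F2_deformation_retract rank_F2_iso comm_group_homology_group_F2)
qed

end
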